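(* For all $0<\alpha<1$ and $r \in \mathbb{N}$ with $r \geq \Omega(1/\alpha^4)$, we have $N^{\mathbb{R}}_\alpha(r) = \Theta(r)$. That is, for every constant $c>0$ there exist constants $c_1,c_2>0$ such that for all $0<\alpha<1$ and all $r \in \mathbb{N}$ with $r \geq c/\alpha^4$, \[ c_1 r \leq N^{\mathbb{R}}_\alpha(r) \leq c_2 r. \]
   Context: $\mathbb{N}$ is the set of positive integers. Lines $l_1,\dots,l_n$ through the origin in $\mathbb{R}^r$ are equiangular with common angle $\arccos(\alpha)$ if, choosing a unit vector $v_i$ along each $l_i$, one has $|\langle v_i, v_j\rangle| = \alpha$ for all $i \neq j$. $N^{\mathbb{R}}_\alpha(r)$ denotes the maximum number of equiangular lines in $\mathbb{R}^r$ with common angle $\arccos(\alpha)$. *)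

theory Defs
  imports Complex_Main "Jordan_Normal_Form.Matrix"
begin

(* The dimension r is quantified inside the statement, below the constants that have to
   be uniform in it, so R^r is the carrier carrier_vec r of real vectors. *)

definition line_through_origin :: "nat \<Rightarrow> real vec set \<Rightarrow> bool" where
  "line_through_origin r l \<longleftrightarrow>
     (\<exists>u \<in> carrier_vec r. u \<noteq> 0\<^sub>v r \<and> l = {t \<cdot>\<^sub>v u | t. True})"

(* A line contains exactly two unit vectors, which differ by sign, so the condition
   does not depend on the choice of v. *)
definition equiangular_lines :: "nat \<Rightarrow> real \<Rightarrow> real vec set set \<Rightarrow> bool" where
  "equiangular_lines r \<alpha> S \<longleftrightarrow>
     (\<forall>l \<in> S. line_through_origin r l) \<and>
     (\<exists>v. (\<forall>l \<in> S. v l \<in> l \<and> v l \<bullet> v l = 1) \<and>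
          (\<forall>l \<in> S. \<forall>m \<in> S. l \<noteq> m \<longrightarrow> \<bar>v l \<bullet> v m\<bar> = \<alpha>))"

(* For 0 \<le> \<alpha> < 1 and r \<ge> 1 the set of cardinalities is finite (Gerzon:
   at most r(r+1)/2), so Max is a genuine maximum there. *)
definition max_equiangular_lines :: "real \<Rightarrow> nat \<Rightarrow> nat" where
  "max_equiangular_lines \<alpha> r = Max {card S | S. finite S \<and> equiangular_lines r \<alpha> S}"

end

(* Since the matrices v_i v_i^T have constant pairwise Frobenius inner product alpha^2, for all p, q
   the numbers <p,v_i><v_i,q> deviate from their mean by at most |p||q| in l^2. Let n be the number
   of lines and choose the signs of the v_i so that s = v_1 + ... + v_n has maximal norm. If
   n >= 10^4 / alpha^4, the pairs p = v_j, q = v_k show that |s|^2 is about alpha n^2, and then the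
   pairs p = v_j, q = s that each v_j has d_j = O(1/alpha^3) negative inner products.
   Cauchy-Schwarz for s and 2 alpha d_j v_j + (sum of the v_i with <v_i,v_j> < 0), with d_j maximal,
   improves this to d_j <= 1/alpha^2. Hence the frame operator of the centred vectors v_i - s/n,
   an r x r matrix, has squared Frobenius norm at most 5n, while its trace is at least n/4 when
   alpha <= 1/2; so n^2/16 <= 5nr. For alpha > 1/2 all inner products can be made positive and
   n <= r + 1. *)
theory Submission
  imports Defs "HOL-Analysis.Convex"
begin

section \<open>Inner products of coordinate functions and Frobenius-norm inequalities\<close>

definition ip :: "nat \<Rightarrow> (nat \<Rightarrow> real) \<Rightarrow> (nat \<Rightarrow> real) \<Rightarrow> real" where
  "ip r x y = (\<Sum>a<r. x a * y a)"

text \<open>Vectors of R^r are functions on \<open>nat\<close> of which only the coordinates below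
  \<open>r\<close> enter \<open>ip\<close>, so \<open>r\<close> can stay a variable.\<close>

definition lc :: "'i set \<Rightarrow> ('i \<Rightarrow> real) \<Rightarrow> ('i \<Rightarrow> nat \<Rightarrow> real) \<Rightarrow> nat \<Rightarrow> real" where
  "lc S c v = (\<lambda>a. \<Sum>i\<in>S. c i * v i a)"

lemma ip_commute: "ip r x y = ip r y x"
  by (simp add: ip_def mult.commute)

lemma ip_lc_left: "ip r (lc S c v) y = (\<Sum>i\<in>S. c i * ip r (v i) y)"
  unfolding ip_def lc_def sum_distrib_right sum_distrib_left
  by (subst sum.swap) (simp add: mult.assoc)

lemma ip_lc_right: "ip r y (lc S c v) = (\<Sum>i\<in>S. c i * ip r y (v i))"
  by (simp add: ip_commute[of r y] ip_lc_left)

lemma ip_nonneg: "0 \<le> ip r x x"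
  unfolding ip_def by (intro sum_nonneg) simp

lemma ip_Cauchy_Schwarz: "(ip r x y)\<^sup>2 \<le> ip r x x * ip r y y"
  using Cauchy_Schwarz_ineq_sum[of x y "{..<r}"] by (simp add: ip_def power2_eq_square)

lemma ip_le_mean: "2 * ip r x y \<le> ip r x x + ip r y y"
proof -
  have "0 \<le> ip r (\<lambda>a. x a - y a) (\<lambda>a. x a - y a)" by (rule ip_nonneg)
  also have "\<dots> = ip r x x - 2 * ip r x y + ip r y y"
    unfolding ip_def sum_distrib_left sum_subtractf[symmetric] sum.distrib[symmetric]
    by (rule sum.cong) (auto simp: algebra_simps)
  finally show ?thesis by simp
qed

text \<open>The left side is the squared Frobenius norm of the sum of the c_i v_i v_i^T, and the
  Frobenius inner product of v_i v_i^T and v_j v_j^T is <v_i, v_j>^2.\<close>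

lemma sum_frame_squares:
  "(\<Sum>a<r. \<Sum>b<r. (\<Sum>i\<in>S. c i * v i a * v i b)\<^sup>2) =
   (\<Sum>i\<in>S. \<Sum>j\<in>S. c i * c j * (ip r (v i) (v j))\<^sup>2)"
proof -
  have "(\<Sum>a<r. \<Sum>b<r. (\<Sum>i\<in>S. c i * v i a * v i b)\<^sup>2) =
        (\<Sum>a<r. \<Sum>b<r. \<Sum>i\<in>S. \<Sum>j\<in>S. (c i * v i a * v i b) * (c j * v j a * v j b))"
    by (simp add: power2_eq_square sum_product)
  also have "\<dots> = (\<Sum>a<r. \<Sum>i\<in>S. \<Sum>b<r. \<Sum>j\<in>S. (c i * v i a * v i b) * (c j * v j a * v j b))"
    by (intro sum.cong refl sum.swap)
  also have "\<dots> = (\<Sum>i\<in>S. \<Sum>a<r. \<Sum>b<r. \<Sum>j\<in>S. (c i * v i a * v i b) * (c j * v j a * v j b))"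
    by (rule sum.swap)
  also have "\<dots> = (\<Sum>i\<in>S. \<Sum>a<r. \<Sum>j\<in>S. \<Sum>b<r. (c i * v i a * v i b) * (c j * v j a * v j b))"
    by (intro sum.cong refl sum.swap)
  also have "\<dots> = (\<Sum>i\<in>S. \<Sum>j\<in>S. \<Sum>a<r. \<Sum>b<r. (c i * v i a * v i b) * (c j * v j a * v j b))"
    by (intro sum.cong refl sum.swap)
  also have "\<dots> = (\<Sum>i\<in>S. \<Sum>j\<in>S. c i * c j * (ip r (v i) (v j))\<^sup>2)"
    by (simp add: ip_def power2_eq_square sum_product sum_distrib_left mult_ac)
  finally show ?thesis .
qed

text \<open>Cauchy-Schwarz for the Frobenius inner product of p q^T, whose norm is |p||q|, with the
  matrix \<open>Y\<close>, the sum of the c_i v_i v_i^T.\<close>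

lemma weighted_frame_bound:
  "(\<Sum>i\<in>S. c i * (ip r p (v i) * ip r (v i) q))\<^sup>2 \<le>
   ip r p p * ip r q q * (\<Sum>i\<in>S. \<Sum>j\<in>S. c i * c j * (ip r (v i) (v j))\<^sup>2)"
proof -
  define Y where "Y a b = (\<Sum>i\<in>S. c i * v i a * v i b)" for a b
  let ?R = "{..<r} \<times> {..<r}"
  have "(\<Sum>i\<in>S. c i * (ip r p (v i) * ip r (v i) q)) =
        (\<Sum>i\<in>S. \<Sum>a<r. \<Sum>b<r. (p a * q b) * (c i * v i a * v i b))"
    unfolding ip_def sum_product by (simp add: sum_distrib_left mult_ac)
  also have "\<dots> = (\<Sum>a<r. \<Sum>i\<in>S. \<Sum>b<r. (p a * q b) * (c i * v i a * v i b))"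
    by (rule sum.swap)
  also have "\<dots> = (\<Sum>a<r. \<Sum>b<r. \<Sum>i\<in>S. (p a * q b) * (c i * v i a * v i b))"
    by (intro sum.cong refl sum.swap)
  also have "\<dots> = (\<Sum>(a,b)\<in>?R. (p a * q b) * Y a b)"
    by (simp add: Y_def sum_distrib_left sum.cartesian_product[symmetric])
  also have "\<dots> = (\<Sum>x\<in>?R. (p (fst x) * q (snd x)) * Y (fst x) (snd x))"
    by (simp add: case_prod_unfold)
  finally have "(\<Sum>i\<in>S. c i * (ip r p (v i) * ip r (v i) q))\<^sup>2 =
    (\<Sum>x\<in>?R. (p (fst x) * q (snd x)) * Y (fst x) (snd x))\<^sup>2" by simp
  also have "\<dots> \<le> (\<Sum>x\<in>?R. (p (fst x) * q (snd x))\<^sup>2) * (\<Sum>x\<in>?R. (Y (fst x) (snd x))\<^sup>2)"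
    by (rule Cauchy_Schwarz_ineq_sum)
  also have "(\<Sum>x\<in>?R. (p (fst x) * q (snd x))\<^sup>2) = (\<Sum>a<r. \<Sum>b<r. (p a * q b)\<^sup>2)"
    by (simp add: sum.cartesian_product case_prod_unfold)
  also have "\<dots> = ip r p p * ip r q q"
    by (simp add: ip_def sum_product power2_eq_square mult_ac)
  also have "(\<Sum>x\<in>?R. (Y (fst x) (snd x))\<^sup>2) = (\<Sum>a<r. \<Sum>b<r. (Y a b)\<^sup>2)"
    by (simp add: sum.cartesian_product case_prod_unfold)
  also have "\<dots> = (\<Sum>i\<in>S. \<Sum>j\<in>S. c i * c j * (ip r (v i) (v j))\<^sup>2)"
    unfolding Y_def by (rule sum_frame_squares)
  finally show ?thesis .
qed

text \<open>The frame operator \<open>Y\<close> has \<open>r\<close> diagonal entries, so its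
  squared trace is at most \<open>r\<close> times the sum of their squares, hence at most
  \<open>r\<close> times its squared Frobenius norm. This brings in the dimension.\<close>

lemma trace_bound:
  "(\<Sum>i\<in>S. ip r (v i) (v i))\<^sup>2 \<le> real r * (\<Sum>i\<in>S. \<Sum>j\<in>S. (ip r (v i) (v j))\<^sup>2)"
proof -
  define Y where "Y a b = (\<Sum>i\<in>S. v i a * v i b)" for a b
  have "(\<Sum>i\<in>S. ip r (v i) (v i)) = (\<Sum>a<r. Y a a)"
    unfolding ip_def Y_def by (rule sum.swap)
  also have "\<dots>\<^sup>2 \<le> real r * (\<Sum>a<r. (Y a a)\<^sup>2)"
    using sum_squared_le_sum_of_squares[of "\<lambda>a. Y a a" "{..<r}"] by (simp add: mult.commute)
  also have "(\<Sum>a<r. (Y a a)\<^sup>2) \<le> (\<Sum>a<r. \<Sum>b<r. (Y a b)\<^sup>2)"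
    by (intro sum_mono member_le_sum[where f = "\<lambda>b. (Y _ b)\<^sup>2"]) auto
  also have "\<dots> = (\<Sum>i\<in>S. \<Sum>j\<in>S. (ip r (v i) (v j))\<^sup>2)"
    using sum_frame_squares[where S = S and c = "\<lambda>_. 1" and v = v and r = r] by (simp add: Y_def)
  finally show ?thesis by (simp add: mult_left_mono)
qed

text \<open>\<open>trace_bound\<close> for the vectors minus their mean. Centring lowers the trace
  by Q / n and the squared Frobenius norm by at least Q^2 / n^2, which is close to its main term
  when most inner products equal \<alpha>.\<close>

lemma centred_trace_bound:
  fixes v :: "'i \<Rightarrow> nat \<Rightarrow> real" and r :: nat
  assumes "finite S" "S \<noteq> {}"
  defines "n \<equiv> real (card S)" and "Q \<equiv> (\<Sum>i\<in>S. \<Sum>j\<in>S. ip r (v i) (v j))"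
  shows "((\<Sum>i\<in>S. ip r (v i) (v i)) - Q / n)\<^sup>2 \<le>
    real r * ((\<Sum>i\<in>S. \<Sum>j\<in>S. (ip r (v i) (v j))\<^sup>2) - Q\<^sup>2 / n\<^sup>2)"
proof -
  define M where "M i j = ip r (v i) (v j)" for i j
  define m where "m i = (\<Sum>j\<in>S. M i j) / n" for i
  define \<mu> where "\<mu> = Q / n\<^sup>2"
  \<comment> \<open>The mean of the vectors, not their sum; \<open>m i\<close> is its inner product
    with \<open>v i\<close>, and \<mu> is its squared norm.\<close>
  define s where "s = (\<lambda>a. (\<Sum>i\<in>S. v i a) / n)"
  define w where "w i = (\<lambda>a. v i a - s a)" for i
  have n: "n > 0" using assms by (simp add: n_def card_gt_0_iff)
  have Msym: "M i j = M j i" for i j by (simp add: M_def ip_commute)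
  have Qm: "(\<Sum>i\<in>S. m i) = n * \<mu>"
    using n by (simp add: m_def \<mu>_def Q_def M_def sum_divide_distrib[symmetric] power2_eq_square)
  have rows: "(\<Sum>j\<in>S. M i j) = n * m i" for i using n by (simp add: m_def)
  have vs: "ip r (v i) s = m i" for i
    unfolding s_def m_def M_def ip_def
    by (subst sum.swap) (simp add: sum_divide_distrib sum_distrib_left)
  have ss: "ip r s s = \<mu>"
  proof -
    have "ip r s s = (\<Sum>i\<in>S. ip r (v i) s) / n"
      unfolding ip_def
      by (subst sum.swap) (simp add: s_def sum_divide_distrib sum_distrib_right)
    also have "\<dots> = \<mu>" using Qm n by (simp add: vs)
    finally show ?thesis .
  qed
  have ww: "ip r (w i) (w j) = M i j - m i - m j + \<mu>" for i j
  proof -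
    have "ip r (w i) (w j) = M i j - ip r (v i) s - ip r (v j) s + ip r s s"
      unfolding ip_def M_def w_def sum_subtractf[symmetric] sum.distrib[symmetric]
      by (rule sum.cong) (auto simp: algebra_simps)
    then show ?thesis by (simp add: vs ss)
  qed
  have cs: "(\<Sum>i\<in>S. c) = n * c" for c :: real by (simp add: n_def)
  have tr: "(\<Sum>i\<in>S. ip r (w i) (w i)) = (\<Sum>i\<in>S. M i i) - Q / n"
  proof -
    have "(\<Sum>i\<in>S. ip r (w i) (w i)) = (\<Sum>i\<in>S. M i i) - 2 * (\<Sum>i\<in>S. m i) + n * \<mu>"
      by (simp only: ww sum_subtractf sum.distrib cs)
    also have "\<dots> = (\<Sum>i\<in>S. M i i) - n * \<mu>" by (simp add: Qm)
    finally show ?thesis using n by (simp add: \<mu>_def power2_eq_square)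
  qed
  define m2 where "m2 = (\<Sum>i\<in>S. (m i)\<^sup>2)"
  define M2 where "M2 = (\<Sum>i\<in>S. \<Sum>j\<in>S. (M i j)\<^sup>2)"
  have row: "(\<Sum>j\<in>S. (ip r (w i) (w j))\<^sup>2) =
     (\<Sum>j\<in>S. (M i j)\<^sup>2) - n * (m i)\<^sup>2 + m2 - n * \<mu>\<^sup>2 + 2 * n * \<mu> * m i - 2 * (\<Sum>j\<in>S. M i j * m j)" for i
  proof -
    \<comment> \<open>Each entry is squared as \<open>M i j - m j + (\<mu> - m i)\<close>, whose
      last summand is constant along row \<open>i\<close>.\<close>
    have "(\<Sum>j\<in>S. (ip r (w i) (w j))\<^sup>2) =
      (\<Sum>j\<in>S. (M i j)\<^sup>2 + (m j)\<^sup>2 - 2 * (M i j * m j) + 2 * (\<mu> - m i) * M i j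
          - 2 * (\<mu> - m i) * m j + (\<mu> - m i)\<^sup>2)"
      unfolding ww by (rule sum.cong) (auto simp: power2_eq_square algebra_simps)
    also have "\<dots> = (\<Sum>j\<in>S. (M i j)\<^sup>2) + m2 - 2 * (\<Sum>j\<in>S. M i j * m j) + 2 * (\<mu> - m i) * (n * m i)
          - 2 * (\<mu> - m i) * (n * \<mu>) + n * (\<mu> - m i)\<^sup>2"
      by (simp only: sum_subtractf sum.distrib cs sum_distrib_left[symmetric] rows Qm m2_def)
    also have "\<dots> = (\<Sum>j\<in>S. (M i j)\<^sup>2) - n * (m i)\<^sup>2 + m2 - n * \<mu>\<^sup>2 + 2 * n * \<mu> * m i
          - 2 * (\<Sum>j\<in>S. M i j * m j)"
      by (simp add: power2_eq_square algebra_simps)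
    finally show ?thesis .
  qed
  have cross: "(\<Sum>i\<in>S. \<Sum>j\<in>S. M i j * m j) = n * m2"
  proof -
    have "(\<Sum>i\<in>S. \<Sum>j\<in>S. M i j * m j) = (\<Sum>j\<in>S. \<Sum>i\<in>S. M j i * m j)"
      by (subst sum.swap) (simp add: Msym)
    also have "\<dots> = (\<Sum>j\<in>S. n * (m j)\<^sup>2)"
      by (simp only: sum_distrib_right[symmetric] rows power2_eq_square mult.assoc)
    finally show ?thesis by (simp add: m2_def sum_distrib_left)
  qed
  have "(\<Sum>i\<in>S. \<Sum>j\<in>S. (ip r (w i) (w j))\<^sup>2) =
    M2 - n * m2 + n * m2 - n * (n * \<mu>\<^sup>2) + 2 * n * \<mu> * (n * \<mu>) - 2 * (n * m2)"
    by (simp only: row sum_subtractf sum.distrib cs sum_distrib_left[symmetric] cross Qm M2_def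
        m2_def[symmetric])
  also have "\<dots> = M2 + n\<^sup>2 * \<mu>\<^sup>2 - 2 * n * m2" by (simp add: power2_eq_square algebra_simps)
  \<comment> \<open>Cauchy-Schwarz for the row means, whose sum is n \<mu>: n times the sum of their
    squares is at least (n \<mu>)^2.\<close>
  also have "\<dots> \<le> M2 - n\<^sup>2 * \<mu>\<^sup>2"
  proof -
    have "(n * \<mu>)\<^sup>2 \<le> n * m2"
      using sum_squared_le_sum_of_squares[of m S] assms by (simp add: Qm m2_def n_def mult.commute)
    then show ?thesis by (simp add: power_mult_distrib mult.commute)
  qed
  also have "n\<^sup>2 * \<mu>\<^sup>2 = Q\<^sup>2 / n\<^sup>2" using n by (simp add: \<mu>_def power_divide power2_eq_square)
  finally have "(\<Sum>i\<in>S. \<Sum>j\<in>S. (ip r (w i) (w j))\<^sup>2) \<le> M2 - Q\<^sup>2 / n\<^sup>2" .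
  then show ?thesis
    using trace_bound[where r = r and v = w and S = S] mult_left_mono[of _ "M2 - Q\<^sup>2 / n\<^sup>2" "real r"]
    by (force simp: tr M2_def M_def)
qed

section \<open>Equiangular systems: variance bound, switching, and the case \<alpha> > 1/2\<close>

lemma two_valued_sum:
  "finite S \<Longrightarrow> (\<Sum>j\<in>S. if j \<in> N then c else 0) = c * real (card (S \<inter> N))"
  by (simp add: sum.If_cases mult.commute)

text \<open>The index type is left open so that the lines themselves can serve as indices
  later.\<close>

locale equiangular_system =
  fixes r :: nat and S :: "'i set" and v :: "'i \<Rightarrow> nat \<Rightarrow> real" and \<alpha> :: real
  assumes fin: "finite S" and \<alpha>_pos: "0 < \<alpha>" and \<alpha>_less_1: "\<alpha> < 1"
    and unit: "\<And>i. i \<in> S \<Longrightarrow> ip r (v i) (v i) = 1"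
    and angle: "\<And>i j. i \<in> S \<Longrightarrow> j \<in> S \<Longrightarrow> i \<noteq> j \<Longrightarrow> \<bar>ip r (v i) (v j)\<bar> = \<alpha>"
begin

abbreviation M :: "'i \<Rightarrow> 'i \<Rightarrow> real" where "M i j \<equiv> ip r (v i) (v j)"

abbreviation n :: real where "n \<equiv> real (card S)"

lemma M_square: "i \<in> S \<Longrightarrow> j \<in> S \<Longrightarrow> (M i j)\<^sup>2 = \<alpha>\<^sup>2 + (if i = j then 1 - \<alpha>\<^sup>2 else 0)"
  using angle[of i j] unit[of i] by (auto simp: power2_eq_square abs_if split: if_splits)

lemma abs_M_le_1: "i \<in> S \<Longrightarrow> j \<in> S \<Longrightarrow> \<bar>M i j\<bar> \<le> 1"
  using angle[of i j] unit[of i] \<alpha>_less_1 by (cases "i = j") auto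

lemma sum_const: "(\<Sum>i\<in>S. c) = n * c"
  by simp

lemma n_pos: "i \<in> S \<Longrightarrow> 0 < n"
  using fin by (auto simp: card_gt_0_iff)

text \<open>The matrices \<open>v\<^sub>i v\<^sub>i\<^sup>T\<close> have constant pairwise Frobenius inner product \<open>\<alpha>\<^sup>2\<close>,
  so a combination of them with coefficients summing to \<open>0\<close> has Frobenius norm at most that of
  its coefficients.\<close>

lemma variance:
  fixes p q
  defines "b \<equiv> \<lambda>i. ip r p (v i) * ip r (v i) q"
  shows "(\<Sum>i\<in>S. (b i - (\<Sum>i\<in>S. b i) / n)\<^sup>2) \<le> ip r p p * ip r q q"
proof (cases "S = {}")
  case True
  then show ?thesis by (simp add: ip_nonneg)
next
  case False
  then have n: "n > 0" using n_pos by auto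
  define c where "c i = b i - (\<Sum>i\<in>S. b i) / n" for i
  define T where "T = (\<Sum>i\<in>S. (c i)\<^sup>2)"
  have c0: "(\<Sum>i\<in>S. c i) = 0" using n by (simp add: c_def sum_subtractf sum_const)
  have "T = (\<Sum>i\<in>S. c i * b i - (\<Sum>i\<in>S. b i) / n * c i)"
    unfolding T_def by (rule sum.cong) (auto simp: c_def power2_eq_square algebra_simps)
  \<comment> \<open>The deviations \<open>c\<close> sum to 0, so the mean subtracted from
    \<open>b\<close> contributes nothing.\<close>
  also have "\<dots> = (\<Sum>i\<in>S. c i * b i)"
    by (simp only: sum_subtractf sum_distrib_left[symmetric] c0)
  finally have T: "T = (\<Sum>i\<in>S. c i * b i)" .
  have "(\<Sum>i\<in>S. \<Sum>j\<in>S. c i * c j * (M i j)\<^sup>2) =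
      (\<Sum>i\<in>S. \<Sum>j\<in>S. \<alpha>\<^sup>2 * c i * c j + (if j = i then (1 - \<alpha>\<^sup>2) * (c i)\<^sup>2 else 0))"
    by (intro sum.cong refl) (auto simp: M_square power2_eq_square[of "c _"] algebra_simps)
  also have "\<dots> = (1 - \<alpha>\<^sup>2) * T"
    using fin by (simp add: sum.distrib sum_distrib_left[symmetric] c0 T_def)
  also have "\<dots> \<le> T"
    by (rule mult_left_le_one_le) (use \<alpha>_pos \<alpha>_less_1 in \<open>auto simp: T_def sum_nonneg power_le_one\<close>)
  \<comment> \<open>\<open>T\<close> is itself the weighted sum of
    \<open>weighted_frame_bound\<close>, with the deviations as weights; the bound thus carries a
    factor \<open>T\<close> on the right, which cancels.\<close>
  finally have "T\<^sup>2 \<le> ip r p p * ip r q q * T"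
    using weighted_frame_bound[of c r p v q S] mult_left_mono[of _ T "ip r p p * ip r q q"]
    unfolding T b_def by (meson ip_nonneg mult_nonneg_nonneg order_trans)
  moreover have "T \<ge> 0" by (simp add: T_def sum_nonneg)
  moreover have "ip r p p * ip r q q \<ge> 0" by (simp add: ip_nonneg)
  ultimately have "T \<le> ip r p p * ip r q q"
    by (cases "T = 0") (auto simp: power2_eq_square mult_le_cancel_right)
  then show ?thesis by (simp add: T_def c_def)
qed

lemma variance_sums:
  fixes p q
  defines "b \<equiv> \<lambda>i. ip r p (v i) * ip r (v i) q"
  shows "n * (\<Sum>i\<in>S. (b i)\<^sup>2) - (\<Sum>i\<in>S. b i)\<^sup>2 \<le> n * (ip r p p * ip r q q)"
proof (cases "S = {}")
  case True
  then show ?thesis by simp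
next
  case False
  then have n: "n > 0" using n_pos by auto
  define B where "B = (\<Sum>i\<in>S. b i)"
  have "(\<Sum>i\<in>S. (b i - B / n)\<^sup>2) = (\<Sum>i\<in>S. (b i)\<^sup>2 - 2 * (B / n) * b i + (B / n)\<^sup>2)"
    by (rule sum.cong) (auto simp: power2_eq_square algebra_simps)
  also have "\<dots> = (\<Sum>i\<in>S. (b i)\<^sup>2) - 2 * (B / n) * B + n * (B / n)\<^sup>2"
    by (simp only: sum_subtractf sum.distrib sum_distrib_left[symmetric] sum_const B_def[symmetric])
  finally have "n * (\<Sum>i\<in>S. (b i - B / n)\<^sup>2) = n * (\<Sum>i\<in>S. (b i)\<^sup>2) - B\<^sup>2"
    using n by (simp add: power2_eq_square field_simps)
  moreover have "n * (\<Sum>i\<in>S. (b i - B / n)\<^sup>2) \<le> n * (ip r p p * ip r q q)"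
    using variance[of p q] n by (simp add: b_def B_def)
  ultimately show ?thesis by (simp add: B_def)
qed

text \<open>A vector and its negative span the same line, so the signs may be chosen freely.\<close>

lemma switch:
  assumes "\<And>i. \<delta> i = 1 \<or> \<delta> i = - 1"
  shows "equiangular_system r S (\<lambda>i a. \<delta> i * v i a) \<alpha>"
proof -
  have *: "ip r (\<lambda>a. \<delta> i * v i a) (\<lambda>a. \<delta> j * v j a) = \<delta> i * \<delta> j * M i j" for i j
    by (simp add: ip_def sum_distrib_left mult_ac)
  have sq: "\<delta> i * \<delta> i = 1" "\<bar>\<delta> i\<bar> = 1" for i using assms[of i] by auto
  show ?thesis
    by unfold_locales (auto simp: * sq fin \<alpha>_pos \<alpha>_less_1 unit angle abs_mult)
qed

lemma sum_M_squares: "(\<Sum>i\<in>S. \<Sum>j\<in>S. (M i j)\<^sup>2) = n * (n * \<alpha>\<^sup>2 + 1 - \<alpha>\<^sup>2)"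
proof -
  have "(\<Sum>i\<in>S. \<Sum>j\<in>S. (M i j)\<^sup>2) = (\<Sum>i\<in>S. \<Sum>j\<in>S. \<alpha>\<^sup>2 + (if j = i then 1 - \<alpha>\<^sup>2 else 0))"
    by (intro sum.cong refl) (auto simp: M_square)
  also have "\<dots> = n * (n * \<alpha>\<^sup>2 + 1 - \<alpha>\<^sup>2)"
    using fin by (simp add: sum.distrib sum_const)
  finally show ?thesis .
qed

lemma centred_bound:
  assumes "S \<noteq> {}"
  defines "Q \<equiv> (\<Sum>i\<in>S. \<Sum>j\<in>S. M i j)"
  shows "(n - Q / n)\<^sup>2 \<le> real r * (n * (n * \<alpha>\<^sup>2 + 1 - \<alpha>\<^sup>2) - Q\<^sup>2 / n\<^sup>2)"
  using centred_trace_bound[OF fin assms(1), of r v]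
  by (simp add: sum_M_squares Q_def unit sum_const)

text \<open>Switch so that all inner products with a fixed \<open>k\<close> are positive. A negative
  pair i, j would then give |w_k - w_i - w_j|^2 = 3 - 6 \<alpha> < 0. So the Gram matrix is (1 -
  \<alpha>) I + \<alpha> J, and \<open>centred_bound\<close> reduces to (n - 1)^2 \<le> r (n -
  1).\<close>

lemma card_le_of_large_angle:
  assumes "1 / 2 < \<alpha>"
  shows "n \<le> real r + 1"
proof (cases "S = {}")
  case True
  then show ?thesis by simp
next
  case False
  then obtain k where k: "k \<in> S" by auto
  define \<delta> where "\<delta> i = (if M i k \<ge> 0 then 1 else - 1 :: real)" for i
  define w where "w = (\<lambda>i a. \<delta> i * v i a)"
  interpret W: equiangular_system r S w \<alpha>
    unfolding w_def by (rule switch) (simp add: \<delta>_def)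
  have wM: "ip r (w i) (w j) = \<delta> i * \<delta> j * M i j" for i j
    by (simp add: w_def ip_def sum_distrib_left mult_ac)
  have wk: "ip r (w i) (w k) = \<alpha>" if "i \<in> S" "i \<noteq> k" for i
  proof -
    have "ip r (w i) (w k) \<ge> 0" using unit[OF k] by (auto simp: wM \<delta>_def)
    then show ?thesis using W.angle[OF that(1) k that(2)] by simp
  qed
  have all: "ip r (w i) (w j) = \<alpha>" if ij: "i \<in> S" "j \<in> S" "i \<noteq> j" for i j
  proof (cases "i = k \<or> j = k")
    case True
    then show ?thesis using wk ij by (auto simp: ip_commute)
  next
    case False
    show ?thesis
    proof (rule ccontr)
      assume "ip r (w i) (w j) \<noteq> \<alpha>"
      then have neg: "ip r (w i) (w j) = - \<alpha>" using W.angle[OF ij] by linarith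
      let ?z = "\<lambda>a. w k a - w i a - w j a"
      have "ip r ?z ?z = ip r (w k) (w k) + ip r (w i) (w i) + ip r (w j) (w j)
          - 2 * ip r (w i) (w k) - 2 * ip r (w j) (w k) + 2 * ip r (w i) (w j)"
        unfolding ip_def sum_distrib_left sum_subtractf[symmetric] sum.distrib[symmetric]
        by (rule sum.cong) (auto simp: algebra_simps)
      also have "\<dots> = 3 - 6 * \<alpha>" using False ij k by (simp add: W.unit wk neg)
      finally show False using ip_nonneg[of r ?z] assms by simp
    qed
  qed
  have n: "n > 0" by (rule n_pos[OF k])
  have "(\<Sum>i\<in>S. \<Sum>j\<in>S. ip r (w i) (w j)) = (\<Sum>i\<in>S. \<Sum>j\<in>S. \<alpha> + (if j = i then 1 - \<alpha> else 0))"
    by (intro sum.cong refl) (auto simp: W.unit all)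
  also have "\<dots> = n * (n * \<alpha> + 1 - \<alpha>)" using fin by (simp add: sum.distrib sum_const)
  finally have "(n - (n * \<alpha> + 1 - \<alpha>))\<^sup>2 \<le>
      real r * (n * (n * \<alpha>\<^sup>2 + 1 - \<alpha>\<^sup>2) - (n * \<alpha> + 1 - \<alpha>)\<^sup>2)"
    using W.centred_bound[OF False] n by (simp add: power_mult_distrib)
  also have "n - (n * \<alpha> + 1 - \<alpha>) = (n - 1) * (1 - \<alpha>)" by (simp add: algebra_simps)
  also have "n * (n * \<alpha>\<^sup>2 + 1 - \<alpha>\<^sup>2) - (n * \<alpha> + 1 - \<alpha>)\<^sup>2 = (n - 1) * (1 - \<alpha>)\<^sup>2"
    by (simp add: power2_eq_square algebra_simps)
  finally have "(1 - \<alpha>)\<^sup>2 * ((n - 1) * (n - 1)) \<le> (1 - \<alpha>)\<^sup>2 * (real r * (n - 1))"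
    by (simp add: power_mult_distrib power2_eq_square mult_ac)
  then have "(n - 1) * (n - 1) \<le> real r * (n - 1)"
    using \<alpha>_less_1 by (simp add: mult_le_cancel_left)
  moreover have "n \<ge> 1" using n by simp
  ultimately show ?thesis by (cases "n = 1") (auto simp: mult_le_cancel_right)
qed

end

section \<open>Consequences of choosing the signs so that the sum has maximal norm\<close>

locale max_equiangular_system = equiangular_system +
  assumes max_norm: "\<And>\<delta>. (\<And>i. \<delta> i = 1 \<or> \<delta> i = - 1) \<Longrightarrow>
    ip r (lc S \<delta> v) (lc S \<delta> v) \<le> ip r (lc S (\<lambda>_. 1) v) (lc S (\<lambda>_. 1) v)"
begin

definition s :: "nat \<Rightarrow> real" where "s = lc S (\<lambda>_. 1) v"
definition Q :: real where "Q = ip r s s"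
definition a :: "'a \<Rightarrow> real" where "a i = ip r (v i) s"
text \<open>The neighbourhoods in the graph of negative pairs. No \<open>j\<close> in
  \<open>S\<close> lies in \<open>N j\<close>, since \<open>M j j\<close> is 1.\<close>

definition N :: "'a \<Rightarrow> 'a set" where "N j = {i \<in> S. M i j < 0}"
definition d :: "'a \<Rightarrow> real" where "d j = real (card (N j))"

lemma N_subset: "N j \<subseteq> S" by (auto simp: N_def)

lemma d_nonneg: "0 \<le> d j" by (simp add: d_def)

lemma a_sum: "a i = (\<Sum>j\<in>S. M i j)"
  by (simp add: a_def s_def ip_lc_right)

lemma sum_a: "(\<Sum>i\<in>S. a i) = Q"
  by (simp add: a_def Q_def) (simp add: s_def ip_lc_left)

lemma Q_sum: "Q = (\<Sum>i\<in>S. \<Sum>j\<in>S. M i j)"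
  by (simp add: sum_a[symmetric] a_sum)

text \<open>By 2<x,y> \<le> |x|^2 + |y|^2, maximality of the norm carries over to inner products of
  two different signed sums.\<close>

lemma bilinear_le_Q:
  assumes "\<And>i. \<sigma> i = 1 \<or> \<sigma> i = - 1" "\<And>i. \<tau> i = 1 \<or> \<tau> i = - 1"
  shows "ip r (lc S \<sigma> v) (lc S \<tau> v) \<le> Q"
  using ip_le_mean[of r "lc S \<sigma> v" "lc S \<tau> v"] max_norm[of \<sigma>] max_norm[of \<tau>] assms
  by (simp add: Q_def s_def)

text \<open>Flipping the sign of \<open>v i\<close> alone changes the squared norm of the sum by 4 -
  4 \<open>a i\<close>, which cannot be positive.\<close>

lemma a_ge_1:
  assumes i: "i \<in> S"
  shows "1 \<le> a i"
proof -
  define \<delta> where "\<delta> j = (if j = i then - 1 else 1 :: real)" for j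
  have "lc S \<delta> v = (\<lambda>x. s x - 2 * v i x)"
  proof
    fix x
    have "lc S \<delta> v x = (\<Sum>j\<in>S. v j x - (if j = i then 2 * v i x else 0))"
      unfolding lc_def by (rule sum.cong) (auto simp: \<delta>_def)
    also have "\<dots> = s x - 2 * v i x" using i fin by (simp add: sum_subtractf s_def lc_def)
    finally show "lc S \<delta> v x = s x - 2 * v i x" .
  qed
  moreover have "ip r (\<lambda>x. s x - 2 * v i x) (\<lambda>x. s x - 2 * v i x) = Q - 4 * a i + 4 * M i i"
    unfolding ip_def Q_def a_def sum_distrib_left sum_subtractf[symmetric] sum.distrib[symmetric]
    by (rule sum.cong) (auto simp: algebra_simps)
  moreover have "ip r (lc S \<delta> v) (lc S \<delta> v) \<le> Q"
    by (rule bilinear_le_Q) (auto simp: \<delta>_def)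
  ultimately show ?thesis using unit[OF i] by simp
qed

lemma M_eq:
  assumes "i \<in> S" "j \<in> S"
  shows "M j i = \<alpha> + (if i = j then 1 - \<alpha> else 0) - (if i \<in> N j then 2 * \<alpha> else 0)"
  using angle[of i j] unit[of i] assms \<alpha>_pos
  by (auto simp: N_def ip_commute[of r "v j" "v i"] abs_if split: if_splits)

lemma a_eq: "j \<in> S \<Longrightarrow> a j = 1 - \<alpha> + \<alpha> * n - 2 * \<alpha> * d j"
proof -
  assume j: "j \<in> S"
  have "a j = (\<Sum>i\<in>S. \<alpha> + (if i = j then 1 - \<alpha> else 0) - (if i \<in> N j then 2 * \<alpha> else 0))"
    unfolding a_sum using j by (intro sum.cong refl) (simp add: M_eq)
  also have "\<dots> = 1 - \<alpha> + \<alpha> * n - 2 * \<alpha> * d j"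
    using j fin N_subset[of j]
    by (simp add: sum.distrib sum_subtractf two_valued_sum d_def Int_absorb1)
  finally show ?thesis .
qed

lemma a_le: "j \<in> S \<Longrightarrow> a j \<le> 1 + \<alpha> * n"
  using a_eq[of j] \<alpha>_pos mult_nonneg_nonneg[of "2 * \<alpha>" "d j"] d_nonneg[of j] by linarith

lemma d_le_half: "j \<in> S \<Longrightarrow> 2 * d j \<le> n"
proof -
  assume j: "j \<in> S"
  have "\<alpha> * (n - 1 - 2 * d j) \<ge> 0" using a_eq[OF j] a_ge_1[OF j] by (simp add: algebra_simps)
  then show ?thesis using \<alpha>_pos by (simp add: zero_le_mult_iff)
qed

lemma Q_le: "Q \<le> n * (1 + \<alpha> * n)"
  using sum_bounded_above[of S a "1 + \<alpha> * n"] a_le by (simp add: sum_a)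

lemma Q_nonneg: "0 \<le> Q"
  by (simp add: Q_def ip_nonneg)

section \<open>Few negative inner products when n is at least 10^4 / \<alpha>^4\<close>

context
  assumes large: "10000 \<le> n * \<alpha> ^ 4"
begin

lemma n_positive: "0 < n"
proof (rule ccontr)
  assume "\<not> 0 < n"
  then have "n = 0" by linarith
  then show False using large by simp
qed

lemma large_powers: "10000 \<le> n * \<alpha> ^ 3" "10000 \<le> n * \<alpha>\<^sup>2" "10000 \<le> n * \<alpha>" "10000 \<le> n"
proof -
  have "10000 \<le> n * \<alpha> ^ k" if "k \<le> 4" for k
  proof -
    have "n * \<alpha> ^ 4 \<le> n * \<alpha> ^ k"
      using n_positive \<alpha>_pos \<alpha>_less_1 that by (intro mult_left_mono power_decreasing) auto
    then show ?thesis using large by linarith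
  qed
  from this[of 3] this[of 2] this[of 1] this[of 0] show
    "10000 \<le> n * \<alpha> ^ 3" "10000 \<le> n * \<alpha>\<^sup>2" "10000 \<le> n * \<alpha>" "10000 \<le> n" by simp_all
qed

text \<open>Variance for \<open>p = v\<^sub>j\<close>, \<open>q = v\<^sub>k\<close>: any two rows of \<open>M\<close> nearly agree up to sign.\<close>

lemma rows_agree:
  assumes "j \<in> S" "k \<in> S"
  shows "99 / 100 * \<alpha>\<^sup>2 * n \<le> \<bar>\<Sum>i\<in>S. M j i * M i k\<bar>"
proof -
  let ?b = "\<lambda>i. M j i * M i k" and ?B = "\<Sum>i\<in>S. M j i * M i k"
  have "\<alpha> ^ 4 \<le> (?b i)\<^sup>2" if i: "i \<in> S" for i
  proof -
    have "\<alpha>\<^sup>2 \<le> (M x y)\<^sup>2" if "x \<in> S" "y \<in> S" for x y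
      using M_square[OF that] \<alpha>_pos \<alpha>_less_1 by (simp add: power_le_one)
    then have "\<alpha>\<^sup>2 * \<alpha>\<^sup>2 \<le> (M j i)\<^sup>2 * (M i k)\<^sup>2"
      using assms i by (intro mult_mono) auto
    then show ?thesis by (simp add: power_mult_distrib)
  qed
  then have "n * \<alpha> ^ 4 \<le> (\<Sum>i\<in>S. (?b i)\<^sup>2)"
    using sum_bounded_below[of S "\<alpha> ^ 4"] by simp
  then have "n * (n * \<alpha> ^ 4) \<le> n * (\<Sum>i\<in>S. (?b i)\<^sup>2)"
    using n_positive by (intro mult_left_mono) auto
  also have "\<dots> \<le> n + ?B\<^sup>2"
    using variance_sums[of "v j" "v k"] assms by (simp add: unit)
  finally have 1: "n * (n * \<alpha> ^ 4) - n \<le> ?B\<^sup>2" by simp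
  have "n * 10000 \<le> n * (n * \<alpha> ^ 4)" using large n_positive by (intro mult_left_mono) auto
  \<comment> \<open>The error \<open>n\<close> is at most 1/10000 of the main term, and 1 -
    (99/100)^2 exceeds that.\<close>
  moreover have "(99 / 100)\<^sup>2 * x \<le> y" if "x - n \<le> y" "n * 10000 \<le> x" for x y :: real
    using that n_positive by (simp add: power2_eq_square)
  ultimately have "(99 / 100)\<^sup>2 * (n * (n * \<alpha> ^ 4)) \<le> ?B\<^sup>2" using 1 by blast
  also have "(99 / 100)\<^sup>2 * (n * (n * \<alpha> ^ 4)) = (99 / 100 * \<alpha>\<^sup>2 * n)\<^sup>2"
    by (simp add: power2_eq_square power4_eq_xxxx)
  finally show ?thesis by (simp add: abs_le_square_iff[symmetric])
qed

text \<open>Let \<open>p\<close> be the sum signed by row \<open>k\<close>. By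
  \<open>rows_agree\<close> every |<v_j, p>| is nearly \<alpha> n, so their sum is nearly \<alpha>
  n^2. Absorbing their signs into \<sigma> turns this sum into an inner product of two signed sums,
  which is at most \<open>Q\<close>.\<close>

lemma Q_ge: "9 / 10 * \<alpha> * n\<^sup>2 \<le> Q"
proof -
  obtain k where k: "k \<in> S" using n_positive by (metis card.empty ex_in_conv less_irrefl of_nat_0)
  define x where "x i = (if M k i < 0 then - 1 else 1 :: real)" for i
  define p where "p = lc S x v"
  \<comment> \<open>Row \<open>k\<close> is \<alpha> times its sign vector except at the diagonal
    entry, whose correction costs at most 1 in the row product.\<close>
  have ax: "\<alpha> * x i = M k i - (if i = k then 1 - \<alpha> else 0)" if "i \<in> S" for i
    using angle[OF k that] unit[OF k] by (auto simp: x_def)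
  have vp: "95 / 100 * \<alpha> * n \<le> \<bar>ip r (v j) p\<bar>" if j: "j \<in> S" for j
  proof -
    have "\<alpha> * ip r (v j) p = (\<Sum>i\<in>S. \<alpha> * x i * M j i)"
      by (simp add: p_def ip_lc_right sum_distrib_left mult.assoc)
    also have "\<dots> = (\<Sum>i\<in>S. M j i * M i k - (if i = k then (1 - \<alpha>) * M j k else 0))"
      by (intro sum.cong refl) (auto simp: ax ip_commute[of r "v k"] algebra_simps)
    also have "\<dots> = (\<Sum>i\<in>S. M j i * M i k) - (1 - \<alpha>) * M j k"
      using fin k by (simp add: sum_subtractf)
    finally have eq: "\<alpha> * ip r (v j) p = (\<Sum>i\<in>S. M j i * M i k) - (1 - \<alpha>) * M j k" .
    have "\<bar>(1 - \<alpha>) * M j k\<bar> \<le> 1 * 1"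
      unfolding abs_mult using abs_M_le_1[OF j k] \<alpha>_pos \<alpha>_less_1 by (intro mult_mono) auto
    then have "99 / 100 * \<alpha>\<^sup>2 * n - 1 \<le> \<bar>\<alpha> * ip r (v j) p\<bar>"
      using rows_agree[OF j k] unfolding eq by linarith
    then have "95 / 100 * (\<alpha>\<^sup>2 * n) \<le> \<bar>\<alpha> * ip r (v j) p\<bar>"
      using large_powers(2) by (simp add: mult.commute)
    then have "\<alpha> * (95 / 100 * \<alpha> * n) \<le> \<alpha> * \<bar>ip r (v j) p\<bar>"
      using \<alpha>_pos by (simp add: abs_mult power2_eq_square mult_ac)
    then show ?thesis using \<alpha>_pos by simp
  qed
  define \<sigma> where "\<sigma> j = (if ip r (v j) p < 0 then - 1 else 1 :: real)" for j
  have "n * (95 / 100 * \<alpha> * n) \<le> (\<Sum>j\<in>S. \<bar>ip r (v j) p\<bar>)"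
    using sum_bounded_below[of S "95 / 100 * \<alpha> * n" "\<lambda>j. \<bar>ip r (v j) p\<bar>"] vp by simp
  also have "\<dots> = ip r (lc S \<sigma> v) p"
    unfolding ip_lc_left by (rule sum.cong) (auto simp: \<sigma>_def)
  also have "\<dots> \<le> Q"
    unfolding p_def by (rule bilinear_le_Q) (auto simp: \<sigma>_def x_def)
  finally have "95 / 100 * (\<alpha> * n\<^sup>2) \<le> Q" by (simp add: power2_eq_square mult_ac)
  moreover have "0 \<le> \<alpha> * n\<^sup>2" using \<alpha>_pos by simp
  ultimately show ?thesis by simp
qed

text \<open>As every \<open>a i\<close> is positive, \<open>b i\<close> has the sign of
  \<open>M j i\<close>. Once the mean \<beta> of \<open>b\<close> is at least \<open>B\<close>, each
  negative neighbour deviates from it by at least \<open>B\<close>, and the total squared deviation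
  is at most \<open>Q\<close>, so there are at most 200 / \<alpha>^3 of them.\<close>

lemma d_small:
  assumes j: "j \<in> S"
  shows "d j \<le> \<alpha> * n / 36"
proof -
  define b where "b i = M j i * a i" for i
  define \<beta> where "\<beta> = (\<Sum>i\<in>S. b i) / n"
  define B where "B = \<alpha>\<^sup>2 * n / 10"
  have B: "0 < B" using n_positive \<alpha>_pos by (simp add: B_def)
  have var: "(\<Sum>i\<in>S. (b i - \<beta>)\<^sup>2) \<le> Q"
    using variance[of "v j" s] unit[OF j] by (simp add: b_def \<beta>_def a_def Q_def)
  have "n * 1 \<le> n * (\<alpha> * n)" using large_powers(3) n_positive by (intro mult_left_mono) (auto simp: mult.commute)
  then have Q2: "Q \<le> 2 * \<alpha> * n\<^sup>2"
    using Q_le by (simp add: power2_eq_square algebra_simps)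
  let ?P = "S - N j"
  \<comment> \<open>Suppose the mean is below \<open>B\<close>. The set \<open>N j\<close> holds at
    most half of the indices and every \<open>a i\<close> is at most 1 + \<alpha> n, so the
    \<open>a i\<close> outside it still sum to about 2/5 \<alpha> n^2. There \<open>b i\<close> is
    at least \<alpha> \<open>a i\<close>, which leaves an excess \<open>X\<close> over the mean of
    about 3/10 (\<alpha> n)^2.\<close>
  have \<beta>: "B \<le> \<beta>"
  proof (rule ccontr)
    assume "\<not> B \<le> \<beta>"
    then have less: "\<beta> < B" by simp
    define X where "X = (\<Sum>i\<in>?P. b i - \<beta>)"
    have "(\<Sum>i\<in>N j. a i) \<le> d j * (1 + \<alpha> * n)"
      using sum_bounded_above[of "N j" a "1 + \<alpha> * n"] a_le N_subset[of j] by (auto simp: d_def)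
    also have "\<dots> \<le> n / 2 * (1 + \<alpha> * n)"
      using d_le_half[OF j] \<alpha>_pos by (intro mult_right_mono) auto
    finally have "Q - n / 2 * (1 + \<alpha> * n) \<le> (\<Sum>i\<in>?P. a i)"
      using sum.subset_diff[OF N_subset fin, of a j] by (simp add: sum_a)
    then have "\<alpha> * (9 / 10 * \<alpha> * n\<^sup>2 - n / 2 * (1 + \<alpha> * n)) \<le> \<alpha> * (\<Sum>i\<in>?P. a i)"
      using Q_ge \<alpha>_pos by (intro mult_left_mono) auto
    also have "\<dots> \<le> (\<Sum>i\<in>?P. b i)"
      unfolding sum_distrib_left
    proof (rule sum_mono)
      fix i assume i: "i \<in> ?P"
      have "\<alpha> \<le> M j i" using i M_eq[of i j] j \<alpha>_less_1 by auto
      then show "\<alpha> * a i \<le> b i"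
        unfolding b_def using a_ge_1[of i] i by (intro mult_right_mono) auto
    qed
    finally have 1: "\<alpha> * (9 / 10 * \<alpha> * n\<^sup>2 - n / 2 * (1 + \<alpha> * n)) \<le> (\<Sum>i\<in>?P. b i)" .
    have cP: "real (card ?P) \<le> n" by (simp add: card_mono fin)
    have "real (card ?P) * \<beta> \<le> real (card ?P) * B" using less by (intro mult_left_mono) auto
    also have "\<dots> \<le> n * B" using cP B by (intro mult_right_mono) auto
    finally have 2: "\<alpha> * (9 / 10 * \<alpha> * n\<^sup>2 - n / 2 * (1 + \<alpha> * n)) - n * B \<le> X"
      using 1 by (simp add: X_def sum_subtractf)
    have "10000 * (n * \<alpha>) \<le> (n * \<alpha>) * (n * \<alpha>)"
      using large_powers(3) by (intro mult_right_mono) auto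
    moreover have "\<alpha> * (9 / 10 * \<alpha> * n\<^sup>2 - n / 2 * (1 + \<alpha> * n)) - n * B =
        3 / 10 * (n * \<alpha>)\<^sup>2 - 1 / 2 * (n * \<alpha>)"
      by (simp add: B_def power2_eq_square field_simps)
    ultimately have X: "(n * \<alpha>)\<^sup>2 / 4 \<le> X"
      using 2 zero_le_power2[of "n * \<alpha>"] unfolding power2_eq_square[symmetric] by linarith
    \<comment> \<open>Cauchy-Schwarz turns this excess into a total squared deviation larger than
      \<open>Q\<close>, because n \<alpha>^3 exceeds 32.\<close>
    have "((n * \<alpha>)\<^sup>2 / 4)\<^sup>2 \<le> X\<^sup>2"
      using X by (intro power_mono) auto
    also have "\<dots> \<le> (\<Sum>i\<in>?P. (b i - \<beta>)\<^sup>2) * real (card ?P)"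
      unfolding X_def by (rule sum_squared_le_sum_of_squares)
    also have "\<dots> \<le> Q * n"
    proof (intro mult_mono)
      have "(\<Sum>i\<in>?P. (b i - \<beta>)\<^sup>2) \<le> (\<Sum>i\<in>S. (b i - \<beta>)\<^sup>2)"
        using fin by (intro sum_mono2) auto
      then show "(\<Sum>i\<in>?P. (b i - \<beta>)\<^sup>2) \<le> Q" using var by simp
    qed (use cP Q_nonneg in auto)
    also have "\<dots> \<le> 2 * \<alpha> * n\<^sup>2 * n" using Q2 by (intro mult_right_mono) auto
    finally have "\<alpha> * n ^ 3 * (n * \<alpha> ^ 3) \<le> \<alpha> * n ^ 3 * 32"
      by (simp add: power2_eq_square power3_eq_cube algebra_simps)
    moreover have "0 < \<alpha> * n ^ 3" using \<alpha>_pos n_positive by simp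
    ultimately have "n * \<alpha> ^ 3 \<le> 32" by (simp only: mult_le_cancel_left_pos)
    then show False using large_powers(1) by simp
  qed
  have "d j * B\<^sup>2 \<le> (\<Sum>i\<in>N j. (b i - \<beta>)\<^sup>2)"
  proof -
    have "B\<^sup>2 \<le> (b i - \<beta>)\<^sup>2" if i: "i \<in> N j" for i
    proof -
      have "b i \<le> 0"
        using i a_ge_1[of i] by (auto simp: b_def N_def ip_commute[of r "v j"] mult_le_0_iff)
      then have "B \<le> \<bar>b i - \<beta>\<bar>" using \<beta> by simp
      then show ?thesis using B by (simp add: abs_le_square_iff[symmetric])
    qed
    then show ?thesis using sum_bounded_below[of "N j" "B\<^sup>2"] by (simp add: d_def)
  qed
  also have "\<dots> \<le> (\<Sum>i\<in>S. (b i - \<beta>)\<^sup>2)" using fin N_subset by (intro sum_mono2) auto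
  also have "\<dots> \<le> 2 * \<alpha> * n\<^sup>2" using var Q2 by simp
  finally have "(\<alpha> * n\<^sup>2) * (d j * \<alpha> ^ 3) \<le> (\<alpha> * n\<^sup>2) * 200"
    by (simp add: B_def power2_eq_square power3_eq_cube algebra_simps)
  moreover have "0 < \<alpha> * n\<^sup>2" using \<alpha>_pos n_positive by simp
  ultimately have "d j * \<alpha> ^ 3 \<le> 200" by (simp only: mult_le_cancel_left_pos)
  \<comment> \<open>This needs n \<alpha>^4 to be at least 200 * 36 = 7200.\<close>
  also have "200 \<le> \<alpha> * n / 36 * \<alpha> ^ 3"
    using large by (simp add: power3_eq_cube power4_eq_xxxx algebra_simps)
  finally show ?thesis using \<alpha>_pos by (simp only: mult_le_cancel_right_pos zero_less_power)
qed

text \<open>Cauchy-Schwarz for \<open>s\<close> and \<open>z\<close>. Maximality of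
  \<open>d j\<close> bounds all row sums below by \<alpha> (n - 2 D). The summand along
  \<open>v j\<close> raises <z, s> by the factor 1 + 2 \<alpha> at no cost in the bound for |z|^2;
  this gain is what survives when the leading terms cancel.\<close>

lemma d_max_bound:
  assumes j: "j \<in> S" and max: "\<And>i. i \<in> S \<Longrightarrow> d i \<le> d j"
  shows "d j * \<alpha>\<^sup>2 \<le> 1"
proof (cases "d j = 0")
  case True
  then show ?thesis by simp
next
  case False
  define D where "D = d j"
  have D: "0 < D" using False d_nonneg[of j] by (simp add: D_def)
  have Dn: "36 * D \<le> \<alpha> * n" using d_small[OF j] by (simp add: D_def)
  \<comment> \<open>With the coefficient 2 \<alpha> D, the square of the \<open>v j\<close> summand
    and its cross term with the neighbours cancel in |z|^2.\<close>
  define c where "c i = (if i = j then 2 * \<alpha> * D else 0) + (if i \<in> N j then 1 else 0)" for i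
  define z where "z = lc S c v"
  have zip: "ip r z y = 2 * \<alpha> * D * ip r (v j) y + (\<Sum>i\<in>N j. ip r (v i) y)" for y
  proof -
    have "ip r z y = (\<Sum>i\<in>S. (if i = j then 2 * \<alpha> * D * ip r (v j) y else 0)
       + (if i \<in> N j then ip r (v i) y else 0))"
      unfolding z_def ip_lc_left by (intro sum.cong refl) (auto simp: c_def algebra_simps)
    also have "\<dots> = 2 * \<alpha> * D * ip r (v j) y + (\<Sum>i\<in>N j. ip r (v i) y)"
      using fin j N_subset[of j] by (simp add: sum.distrib sum.inter_restrict[symmetric] Int_absorb1)
    finally show ?thesis .
  qed
  have finN: "finite (N j)" by (rule finite_subset[OF N_subset fin])
  have vN: "(\<Sum>i\<in>N j. M i j) = - \<alpha> * D"
  proof -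
    have "(\<Sum>i\<in>N j. M i j) = (\<Sum>i\<in>N j. - \<alpha>)"
    proof (rule sum.cong)
      fix i assume "i \<in> N j"
      then have "i \<in> S" "M i j < 0" "i \<noteq> j" using unit[OF j] by (auto simp: N_def)
      then show "M i j = - \<alpha>" using angle[of i j] j by simp
    qed simp
    then show ?thesis by (simp add: D_def d_def)
  qed
  have NN: "(\<Sum>i\<in>N j. \<Sum>k\<in>N j. M k i) \<le> D + \<alpha> * D\<^sup>2"
  proof -
    have "(\<Sum>i\<in>N j. \<Sum>k\<in>N j. M k i) \<le> (\<Sum>i\<in>N j. \<Sum>k\<in>N j. \<alpha> + (if k = i then 1 else 0))"
    proof (intro sum_mono)
      fix i k assume "i \<in> N j" "k \<in> N j"
      then have "i \<in> S" "k \<in> S" using N_subset by auto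
      then show "M k i \<le> \<alpha> + (if k = i then 1 else 0)"
        using angle[of k i] unit[of k] \<alpha>_pos by (cases "k = i") auto
    qed
    also have "\<dots> = D + \<alpha> * D\<^sup>2"
      using finN by (simp add: sum.distrib D_def d_def power2_eq_square algebra_simps)
    finally show ?thesis .
  qed
  have "ip r z z = 2 * \<alpha> * D * ip r z (v j) + (\<Sum>i\<in>N j. ip r z (v i))"
    by (subst zip) (simp add: ip_commute[of r z])
  also have "ip r z (v j) = \<alpha> * D" using unit[OF j] by (simp add: zip vN)
  also have "(\<Sum>i\<in>N j. ip r z (v i)) = 2 * \<alpha> * D * (- \<alpha> * D) + (\<Sum>i\<in>N j. \<Sum>k\<in>N j. M k i)"
    using vN by (simp add: zip sum.distrib sum_distrib_left[symmetric] ip_commute[of r "v j"])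
  finally have zz: "ip r z z \<le> D + \<alpha> * D\<^sup>2" using NN by simp
  have an: "\<alpha> * (n - 2 * D) \<le> a i" if "i \<in> S" for i
  proof -
    have "\<alpha> * d i \<le> \<alpha> * D" using max[OF that] \<alpha>_pos by (simp add: D_def)
    then show ?thesis using a_eq[OF that] \<alpha>_less_1 by (simp add: algebra_simps)
  qed
  have "D * (\<alpha> * (n - 2 * D)) \<le> (\<Sum>i\<in>N j. a i)"
    using sum_bounded_below[of "N j" "\<alpha> * (n - 2 * D)" a] an N_subset[of j] by (auto simp: D_def d_def)
  moreover have "2 * \<alpha> * D * (\<alpha> * (n - 2 * D)) \<le> 2 * \<alpha> * D * a j"
    using an[OF j] \<alpha>_pos D by (intro mult_left_mono) auto
  ultimately have zs: "(2 * \<alpha> * D + D) * (\<alpha> * (n - 2 * D)) \<le> ip r z s"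
    by (simp add: zip a_def[symmetric] algebra_simps)
  have "\<alpha> * n \<le> n" using mult_right_mono[of \<alpha> 1 n] \<alpha>_less_1 by simp
  then have "0 \<le> n - 2 * D" using Dn D by linarith
  then have "((2 * \<alpha> * D + D) * (\<alpha> * (n - 2 * D)))\<^sup>2 \<le> (ip r z s)\<^sup>2"
    using zs \<alpha>_pos D by (intro power_mono) auto
  also have "\<dots> \<le> ip r z z * Q" unfolding Q_def by (rule ip_Cauchy_Schwarz)
  also have "\<dots> \<le> (D + \<alpha> * D\<^sup>2) * (n * (1 + \<alpha> * n))"
    using zz Q_le Q_nonneg D \<alpha>_pos by (intro mult_mono) auto
  finally have "D * (D * (1 + 2 * \<alpha>)\<^sup>2 * \<alpha>\<^sup>2 * (n - 2 * D)\<^sup>2) \<le>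
      D * ((1 + \<alpha> * D) * (n * (1 + \<alpha> * n)))"
    by (simp add: power2_eq_square algebra_simps)
  then have 1: "D * (1 + 2 * \<alpha>)\<^sup>2 * \<alpha>\<^sup>2 * (n - 2 * D)\<^sup>2 \<le> (1 + \<alpha> * D) * (n * (1 + \<alpha> * n))"
    using D by (simp only: mult_le_cancel_left_pos)
  have "n * (n - 4 * D) \<le> (n - 2 * D)\<^sup>2" by (simp add: power2_eq_square algebra_simps)
  then have "D * (1 + 2 * \<alpha>)\<^sup>2 * \<alpha>\<^sup>2 * (n * (n - 4 * D)) \<le> D * (1 + 2 * \<alpha>)\<^sup>2 * \<alpha>\<^sup>2 * (n - 2 * D)\<^sup>2"
    using D \<alpha>_pos by (intro mult_left_mono) auto
  with 1 have "n * (D * (1 + 2 * \<alpha>)\<^sup>2 * \<alpha>\<^sup>2 * (n - 4 * D)) \<le> n * ((1 + \<alpha> * D) * (1 + \<alpha> * n))"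
    by (simp add: mult_ac)
  then have 2: "D * (1 + 2 * \<alpha>)\<^sup>2 * \<alpha>\<^sup>2 * (n - 4 * D) \<le> (1 + \<alpha> * D) * (1 + \<alpha> * n)"
    using n_positive by (simp only: mult_le_cancel_left_pos)
  have "\<alpha> * \<alpha> \<le> \<alpha>" using \<alpha>_pos \<alpha>_less_1 by simp
  then have b1: "1 + 4 * \<alpha> \<le> (1 + 2 * \<alpha>)\<^sup>2" and b2: "(1 + 2 * \<alpha>)\<^sup>2 \<le> 9"
    using \<alpha>_less_1 by (auto simp: power2_eq_square algebra_simps)
  have c1: "D * \<alpha>\<^sup>2 * n * (1 + 4 * \<alpha>) \<le> D * \<alpha>\<^sup>2 * n * (1 + 2 * \<alpha>)\<^sup>2"
    using b1 D n_positive by (intro mult_left_mono) auto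
  have c2: "D * \<alpha>\<^sup>2 * (4 * D) * (1 + 2 * \<alpha>)\<^sup>2 \<le> D * \<alpha>\<^sup>2 * (4 * D) * 9"
    using b2 D by (intro mult_left_mono) auto
  have c3: "D * \<alpha>\<^sup>2 * (36 * D) \<le> D * \<alpha>\<^sup>2 * (\<alpha> * n)"
    using Dn D by (intro mult_left_mono) auto
  have c4: "\<alpha> * D \<le> D" using \<alpha>_less_1 D by simp
  \<comment> \<open>The terms D \<alpha>^2 n on both sides cancel. Of the surplus 4 D \<alpha>^3 n,
    one part pays for 36 D^2 \<alpha>^2 by 36 D \<le> \<alpha> n, and three parts remain.\<close>
  have "3 * (D * \<alpha>\<^sup>2 * (\<alpha> * n)) \<le> 1 + \<alpha> * D + \<alpha> * n"
    using 2 c1 c2 c3 by (simp add: power2_eq_square algebra_simps)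
  also have "\<dots> \<le> 3 * (\<alpha> * n)" using c4 Dn D large_powers(3) unfolding mult.commute[of n] by linarith
  finally have "(\<alpha> * n) * (D * \<alpha>\<^sup>2) \<le> (\<alpha> * n) * 1" by (simp add: mult_ac)
  moreover have "0 < \<alpha> * n" using \<alpha>_pos n_positive by simp
  ultimately show ?thesis unfolding D_def by (simp only: mult_le_cancel_left_pos)
qed

text \<open>With d_i \<le> 1 / \<alpha>^2, Q / n falls short of \<alpha> n by at most 2 / \<alpha>,
  so the main term n^2 \<alpha>^2 of the squared Frobenius norm cancels up to 4 n. The constant 80
  is 5 * 16, from (n / 4)^2 \<le> 5 n r.\<close>

lemma n_le_80_r:
  assumes "\<alpha> \<le> 1 / 2"
  shows "n \<le> 80 * real r"
proof -
  have ne: "S \<noteq> {}" using n_positive by auto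
  have "d i * \<alpha>\<^sup>2 \<le> 1" if i: "i \<in> S" for i
  proof -
    have "Max (d ` S) \<in> d ` S" using fin ne by (intro Max_in) auto
    then obtain j where j: "j \<in> S" "d j = Max (d ` S)" by auto
    have max: "d i \<le> d j" if "i \<in> S" for i using fin that j by simp
    have "d i * \<alpha>\<^sup>2 \<le> d j * \<alpha>\<^sup>2" using max[OF i] by (intro mult_right_mono) auto
    also have "\<dots> \<le> 1" by (rule d_max_bound[OF j(1) max])
    finally show ?thesis .
  qed
  then have "\<alpha> * d i \<le> 1 / \<alpha>" if "i \<in> S" for i
    using that \<alpha>_pos by (simp add: pos_le_divide_eq power2_eq_square mult_ac)
  then have "\<alpha> * n - 2 * (1 / \<alpha>) \<le> a i" if "i \<in> S" for i
    using a_eq[OF that] that \<alpha>_less_1 by force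
  then have "\<alpha> * n - 2 / \<alpha> \<le> a i" if "i \<in> S" for i
    using that by simp
  then have "n * (\<alpha> * n - 2 / \<alpha>) \<le> Q"
    using sum_bounded_below[of S "\<alpha> * n - 2 / \<alpha>" a] by (simp add: sum_a)
  then have Qn: "\<alpha> * n - 2 / \<alpha> \<le> Q / n" using n_positive by (simp add: field_simps)
  have "10000 \<le> (\<alpha> * n) * \<alpha>" using large_powers(2) by (simp add: power2_eq_square mult_ac)
  then have "0 \<le> \<alpha> * n - 2 / \<alpha>" using \<alpha>_pos by (simp add: field_simps)
  then have "(\<alpha> * n - 2 / \<alpha>)\<^sup>2 \<le> (Q / n)\<^sup>2" using Qn by (intro power_mono) auto
  moreover have "(\<alpha> * n - 2 / \<alpha>)\<^sup>2 \<ge> n\<^sup>2 * \<alpha>\<^sup>2 - 4 * n"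
    using \<alpha>_pos by (simp add: power2_diff power_mult_distrib)
  ultimately have Q2: "n\<^sup>2 * \<alpha>\<^sup>2 - 4 * n \<le> Q\<^sup>2 / n\<^sup>2" by (simp add: power_divide)
  have "n * (n * \<alpha>\<^sup>2 + 1 - \<alpha>\<^sup>2) - Q\<^sup>2 / n\<^sup>2 \<le> 5 * n"
  proof -
    have "0 \<le> n * \<alpha>\<^sup>2" by simp
    then show ?thesis using Q2 by (simp add: power2_eq_square algebra_simps)
  qed
  then have 1: "(n - Q / n)\<^sup>2 \<le> real r * (5 * n)"
    using centred_bound[OF ne] mult_left_mono[of _ "5 * n" "real r"] unfolding Q_sum[symmetric]
    by (meson of_nat_0_le_iff order_trans)
  \<comment> \<open>The centred trace stays large because Q / n is at most 1 + n / 2 for \<alpha>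
    \<le> 1/2.\<close>
  have "Q / n \<le> 1 + \<alpha> * n" using Q_le n_positive by (simp add: field_simps)
  moreover have "\<alpha> * n \<le> 1 / 2 * n" using assms by (intro mult_right_mono) auto
  ultimately have "n / 4 \<le> n - Q / n" using large_powers(4) by linarith
  then have "(n / 4)\<^sup>2 \<le> (n - Q / n)\<^sup>2" by (intro power_mono) auto
  with 1 have "n * n \<le> n * (80 * real r)" by (simp add: power2_eq_square mult_ac)
  then show ?thesis using n_positive by (simp only: mult_le_cancel_left_pos)
qed

end

end

section \<open>Existence of an optimal sign choice and the linear upper bound\<close>

lemma (in equiangular_system) exists_max_switching:
  "\<exists>\<delta>. max_equiangular_system r S (\<lambda>i a. \<delta> i * v i a) \<alpha>"
proof -
  define F where "F \<delta> = ip r (lc S \<delta> v) (lc S \<delta> v)" for \<delta>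
  \<comment> \<open>Extensional sign functions on \<open>S\<close> form a finite set, so a maximum
    exists.\<close>
  let ?D = "PiE S (\<lambda>_. {1, - 1 :: real})"
  have finD: "finite ?D" using fin by (intro finite_PiE) auto
  have neD: "?D \<noteq> {}" by (simp add: PiE_eq_empty_iff)
  have "Max (F ` ?D) \<in> F ` ?D" using finD neD by (intro Max_in) auto
  then obtain \<delta>0 where \<delta>0: "\<delta>0 \<in> ?D" "F \<delta>0 = Max (F ` ?D)" by auto
  \<comment> \<open>The signs are reset to 1 outside \<open>S\<close>, because \<open>switch\<close>
    asks for a sign at every index.\<close>
  define \<delta> where "\<delta> i = (if i \<in> S then \<delta>0 i else 1)" for i
  have \<delta>: "\<delta> i = 1 \<or> \<delta> i = - 1" for i using \<delta>0(1) by (auto simp: \<delta>_def PiE_iff)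
  have F_cong: "F \<eta> = F \<eta>'" if "\<And>i. i \<in> S \<Longrightarrow> \<eta> i = \<eta>' i" for \<eta> \<eta>'
  proof -
    have "lc S \<eta> v = lc S \<eta>' v" unfolding lc_def using that by auto
    then show ?thesis by (simp add: F_def)
  qed
  have F_max: "F \<eta> \<le> F \<delta>" if "\<And>i. \<eta> i = 1 \<or> \<eta> i = - 1" for \<eta>
  proof -
    have "restrict \<eta> S \<in> ?D" using that by auto
    then have "F (restrict \<eta> S) \<le> F \<delta>0" using finD \<delta>0(2) by simp
    moreover have "F (restrict \<eta> S) = F \<eta>" by (rule F_cong) simp
    moreover have "F \<delta>0 = F \<delta>" by (rule F_cong) (simp add: \<delta>_def)
    ultimately show ?thesis by simp
  qed
  interpret W: equiangular_system r S "\<lambda>i a. \<delta> i * v i a" \<alpha> by (rule switch[OF \<delta>])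
  have lc: "lc S \<eta> (\<lambda>i a. \<delta> i * v i a) = lc S (\<lambda>i. \<eta> i * \<delta> i) v" for \<eta>
    by (simp add: lc_def mult.assoc)
  have "max_equiangular_system r S (\<lambda>i a. \<delta> i * v i a) \<alpha>"
  proof unfold_locales
    fix \<eta> :: "'i \<Rightarrow> real"
    assume \<eta>: "\<And>i. \<eta> i = 1 \<or> \<eta> i = - 1"
    \<comment> \<open>Signs multiply, so a competitor \<eta> of the switched system is the
      competitor \<eta> \<delta> of the original one.\<close>
    have "F (\<lambda>i. \<eta> i * \<delta> i) \<le> F \<delta>"
      by (rule F_max) (use \<eta> \<delta> in \<open>metis mult_1 mult_minus1 minus_minus\<close>)
    then show "ip r (lc S \<eta> (\<lambda>i a. \<delta> i * v i a)) (lc S \<eta> (\<lambda>i a. \<delta> i * v i a))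
      \<le> ip r (lc S (\<lambda>_. 1) (\<lambda>i a. \<delta> i * v i a)) (lc S (\<lambda>_. 1) (\<lambda>i a. \<delta> i * v i a))"
      by (simp add: lc F_def)
  qed
  then show ?thesis by blast
qed

text \<open>If n \<alpha>^4 < 10^4, the assumption on \<open>r\<close> alone suffices: n < 10^4 /
  \<alpha>^4 \<le> (10^4 / c) r. The other cases give r + 1 or 80 r.\<close>

lemma (in equiangular_system) card_le_linear:
  assumes "0 < c" "1 \<le> r" "c / \<alpha> ^ 4 \<le> real r"
  shows "n \<le> max 80 (10000 / c) * real r"
proof -
  obtain \<delta> where "max_equiangular_system r S (\<lambda>i a. \<delta> i * v i a) \<alpha>"
    using exists_max_switching by blast
  then interpret W: max_equiangular_system r S "\<lambda>i a. \<delta> i * v i a" \<alpha> .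
  consider "1 / 2 < \<alpha>" | "\<alpha> \<le> 1 / 2" "10000 \<le> n * \<alpha> ^ 4" | "n * \<alpha> ^ 4 < 10000" by linarith
  then have "n \<le> 80 * real r \<or> n \<le> 10000 / c * real r"
  proof cases
    case 1
    then show ?thesis using card_le_of_large_angle assms by linarith
  next
    case 2
    then show ?thesis using W.n_le_80_r by simp
  next
    case 3
    then have "n < 10000 / \<alpha> ^ 4" using \<alpha>_pos by (simp add: pos_less_divide_eq)
    also have "\<dots> = 10000 / c * (c / \<alpha> ^ 4)" using assms by simp
    also have "\<dots> \<le> 10000 / c * real r" using assms by (intro mult_left_mono) auto
    finally show ?thesis by simp
  qed
  moreover have "80 * real r \<le> max 80 (10000 / c) * real r"
    "10000 / c * real r \<le> max 80 (10000 / c) * real r"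
    by (intro mult_right_mono; simp)+
  ultimately show ?thesis by linarith
qed

section \<open>Transfer to lines in \<open>carrier_vec r\<close>\<close>

lemma scalar_prod_ip:
  assumes "w \<in> carrier_vec r"
  shows "u \<bullet> w = ip r (\<lambda>a. u $ a) (\<lambda>a. w $ a)"
  by (simp only: scalar_prod_def ip_def atLeast0LessThan carrier_vecD[OF assms])

lemma card_equiangular_lines_le:
  assumes S: "finite S" "equiangular_lines r \<alpha> S" and \<alpha>: "0 < \<alpha>" "\<alpha> < 1"
    and c: "0 < c" "1 \<le> r" "c / \<alpha> ^ 4 \<le> real r"
  shows "real (card S) \<le> max 80 (10000 / c) * real r"
proof -
  obtain v :: "real vec set \<Rightarrow> real vec" where v: "\<forall>l\<in>S. v l \<in> l \<and> v l \<bullet> v l = 1"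
    "\<forall>l\<in>S. \<forall>m\<in>S. l \<noteq> m \<longrightarrow> \<bar>v l \<bullet> v m\<bar> = \<alpha>"
    using S(2) unfolding equiangular_lines_def by (elim conjE exE) (rule that)
  have carr: "v l \<in> carrier_vec r" if l: "l \<in> S" for l
  proof -
    obtain u where "u \<in> carrier_vec r" "l = {t \<cdot>\<^sub>v u | t. True}"
      using S(2) l unfolding equiangular_lines_def line_through_origin_def by blast
    then show ?thesis using v(1) l by auto
  qed
  have ip: "ip r (($) (v l)) (($) (v m)) = v l \<bullet> v m" if "m \<in> S" for l m
    by (rule scalar_prod_ip[symmetric, OF carr[OF that]])
  interpret equiangular_system r S "\<lambda>l a. v l $ a" \<alpha>
    by unfold_locales (simp_all add: S(1) \<alpha> ip v)
  show ?thesis by (rule card_le_linear[OF c])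
qed

section \<open>Lower bound: \<open>r\<close> equiangular lines for every \<alpha>\<close>

text \<open>The vectors \<open>x e\<^sub>i + y 1\<close> with \<open>x\<^sup>2 = 1 - \<alpha>\<close> and \<open>2 x y + r y\<^sup>2 = \<alpha>\<close>.\<close>

lemma exists_equiangular_lines:
  assumes \<alpha>: "0 < \<alpha>" "\<alpha> < 1" and r: "1 \<le> r"
  shows "\<exists>S. finite S \<and> card S = r \<and> equiangular_lines r \<alpha> S"
proof -
  define x where "x = sqrt (1 - \<alpha>)"
  define y where "y = (sqrt (x\<^sup>2 + real r * \<alpha>) - x) / real r"
  have x2: "x\<^sup>2 = 1 - \<alpha>" using \<alpha> by (simp add: x_def)
  \<comment> \<open>Completing the square: the equation for \<open>y\<close> is equivalent to (r y +
    x)^2 = x^2 + r \<alpha>.\<close>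
  have "real r * y + x = sqrt (x\<^sup>2 + real r * \<alpha>)" using r by (simp add: y_def)
  then have "(real r * y + x)\<^sup>2 = x\<^sup>2 + real r * \<alpha>" using \<alpha> by simp
  then have "real r * (2 * x * y + real r * y\<^sup>2) = real r * \<alpha>"
    by (simp add: power2_eq_square algebra_simps)
  then have xy: "2 * x * y + real r * y\<^sup>2 = \<alpha>" using r by simp
  define u where "u i = vec r (\<lambda>a. (if a = i then x else 0) + y)" for i
  have uc: "u i \<in> carrier_vec r" for i by (simp add: u_def)
  have uu: "u i \<bullet> u j = (if i = j then 1 else \<alpha>)" if "i < r" "j < r" for i j
  proof -
    have "u i \<bullet> u j = (\<Sum>a\<in>{0..<r}. (if a = i then (if i = j then x\<^sup>2 else 0) else 0)
        + (if a = i then x * y else 0) + (if a = j then x * y else 0) + y\<^sup>2)"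
      unfolding scalar_prod_def u_def
      by (auto intro!: sum.cong simp: power2_eq_square algebra_simps)
    also have "\<dots> = (if i = j then x\<^sup>2 else 0) + (2 * x * y + real r * y\<^sup>2)"
      using that by (simp add: sum.distrib)
    finally show ?thesis by (simp add: xy x2)
  qed
  define L where "L i = {t \<cdot>\<^sub>v u i | t. True}" for i
  have unit_in_L: "w = u i \<or> w = - u i" if i: "i < r" and w: "w \<in> L i" "w \<bullet> w = 1" for i and w :: "real vec"
  proof -
    obtain t where t: "w = t \<cdot>\<^sub>v u i" using w(1) by (auto simp: L_def)
    then have "t * t = 1" using i w(2) uu[of i i] uc[of i] by simp
    then have "t = 1 \<or> t = - 1" by (simp add: square_eq_1_iff)
    then show ?thesis using t uc[of i] by auto
  qed
  have uL: "u i \<in> L i" for i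
    using uc[of i] unfolding L_def by (auto intro!: exI[of _ "1 :: real"])
  \<comment> \<open>If two of the lines coincide, their unit vectors agree up to sign, so the inner
    product has absolute value 1, which differs from \<alpha>.\<close>
  have inj: "inj_on L {..<r}"
  proof (rule inj_onI)
    fix i j assume ij: "i \<in> {..<r}" "j \<in> {..<r}" "L i = L j"
    then have "u i = u j \<or> u i = - u j"
      using unit_in_L[of j "u i"] uL[of i] uu[of i i] by auto
    then have "\<bar>u i \<bullet> u j\<bar> = 1" using uu[of j j] ij uc[of j] by auto
    then show "i = j" using uu[of i j] ij \<alpha> by (auto split: if_splits)
  qed
  have "equiangular_lines r \<alpha> (L ` {..<r})"
    unfolding equiangular_lines_def
  proof (intro conjI ballI)
    fix l assume "l \<in> L ` {..<r}"
    then obtain i where i: "i < r" "l = L i" by auto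
    have "u i \<noteq> 0\<^sub>v r" using uu[of i i] i by auto
    then show "line_through_origin r l"
      unfolding line_through_origin_def using i uc[of i] by (auto simp: L_def)
  next
    define v where "v = (\<lambda>l. u (the_inv_into {..<r} L l))"
    have v: "v (L i) = u i" if "i < r" for i
      using that by (simp add: v_def the_inv_into_f_f[OF inj])
    show "\<exists>v. (\<forall>l\<in>L ` {..<r}. v l \<in> l \<and> v l \<bullet> v l = 1) \<and>
      (\<forall>l\<in>L ` {..<r}. \<forall>m\<in>L ` {..<r}. l \<noteq> m \<longrightarrow> \<bar>v l \<bullet> v m\<bar> = \<alpha>)"
      by (rule exI[of _ v]) (use \<alpha> in \<open>auto simp: v uL uu\<close>)
  qed
  then show ?thesis using inj by (intro exI[of _ "L ` {..<r}"]) (simp add: card_image)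
qed

section \<open>Linear growth of the maximum\<close>

theorem corollary1p8:
  fixes c :: real
  assumes "c > 0"
  shows "\<exists>c1 c2 :: real. c1 > 0 \<and> c2 > 0 \<and>
           (\<forall>(\<alpha>::real) (r::nat). 0 < \<alpha> \<and> \<alpha> < 1 \<and> r \<ge> 1 \<and> real r \<ge> c / \<alpha> ^ 4 \<longrightarrow>
              c1 * real r \<le> real (max_equiangular_lines \<alpha> r) \<and>
              real (max_equiangular_lines \<alpha> r) \<le> c2 * real r)"
proof (intro exI conjI allI impI)
  let ?C = "max 80 (10000 / c)"
  show "(1 :: real) > 0" "?C > 0" by auto
  fix \<alpha> :: real and r :: nat
  assume *: "0 < \<alpha> \<and> \<alpha> < 1 \<and> r \<ge> 1 \<and> real r \<ge> c / \<alpha> ^ 4"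
  let ?X = "{card S | S. finite S \<and> equiangular_lines r \<alpha> S}"
  have le: "real k \<le> ?C * real r" if "k \<in> ?X" for k
    using that card_equiangular_lines_le[of _ r \<alpha> c] * assms by blast
  \<comment> \<open>The upper bound also makes the set of cardinalities finite, so that
    \<open>Max\<close> is attained.\<close>
  have "k \<le> nat \<lfloor>?C * real r\<rfloor>" if "k \<in> ?X" for k
    using le[OF that] by (simp add: le_nat_floor)
  then have fin: "finite ?X" unfolding finite_nat_set_iff_bounded_le by blast
  have r: "r \<in> ?X" using exists_equiangular_lines[of \<alpha> r] * by blast
  have "Max ?X \<in> ?X" using fin r by (intro Max_in) auto
  then show "real (max_equiangular_lines \<alpha> r) \<le> ?C * real r"
    unfolding max_equiangular_lines_def by (rule le)
  show "1 * real r \<le> real (max_equiangular_lines \<alpha> r)"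
    unfolding max_equiangular_lines_def using Max_ge[OF fin r] by simp
qed

end
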